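(* Let $m$ be a positive integer and let $0<A<1$. Let $\{(x_n,y_n,z_n)\}_{n\ge -m}$ be an arbitrary positive solution of the system $$x_{n+1}=A+\frac{x_{n-m}}{z_n},\quad y_{n+1}=A+\frac{y_{n-m}}{z_n},\quad z_{n+1}=A+\frac{z_{n-m}}{y_n},\qquad n=0,1,2,\dots$$ Then the following statements are true. (i) If $m$ is odd and, for every $k\in\{\frac{1-m}{2},\frac{3-m}{2},\dots,0\}$, $0<x_{2k-1}<1$, $0<y_{2k-1}<1$, $0<z_{2k-1}<1$, $x_{2k}>\frac{1}{1-A}$, $y_{2k}>\frac{1}{1-A}$, $z_{2k}>\frac{1}{1-A}$, then $$\lim_{n\to\infty}x_{2n}=\lim_{n\to\infty}y_{2n}=\lim_{n\to\infty}z_{2n}=\infty,\qquad \lim_{n\to\infty}x_{2n+1}=\lim_{n\to\infty}y_{2n+1}=\lim_{n\to\infty}z_{2n+1}=A.$$ (ii) If $m$ is odd and, for every $k\in\{\frac{1-m}{2},\frac{3-m}{2},\dots,0\}$, $0<x_{2k}<1$, $0<y_{2k}<1$, $0<z_{2k}<1$, $x_{2k-1}>\frac{1}{1-A}$, $y_{2k-1}>\frac{1}{1-A}$, $z_{2k-1}>\frac{1}{1-A}$, then $$\lim_{n\to\infty}x_{2n}=\lim_{n\to\infty}y_{2n}=\lim_{n\to\infty}z_{2n}=A,\qquad \lim_{n\to\infty}x_{2n+1}=\lim_{n\to\infty}y_{2n+1}=\lim_{n\to\infty}z_{2n+1}=\infty.$$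
   Context: A positive solution of the system is a sequence $\{(x_n,y_n,z_n)\}_{n\ge -m}$ satisfying the recursion for all $n\ge 0$ whose initial values $x_{-i},y_{-i},z_{-i}$, $i=0,1,\dots,m$, are positive real numbers (all later terms are then positive). *)

theory Defs
  imports Complex_Main
begin

text \<open>
  Sequences indexed by the integers \<open>n \<ge> -m\<close> are functions on \<open>int\<close>; their values below
  \<open>-m\<close> are unconstrained.
\<close>

definition positive_solution ::
  "real \<Rightarrow> nat \<Rightarrow> (int \<Rightarrow> real) \<Rightarrow> (int \<Rightarrow> real) \<Rightarrow> (int \<Rightarrow> real) \<Rightarrow> bool" where
  "positive_solution A m x y z \<longleftrightarrow>
     (\<forall>i\<in>{0..int m}. 0 < x (- i) \<and> 0 < y (- i) \<and> 0 < z (- i)) \<and>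
     (\<forall>n\<ge>0. x (n + 1) = A + x (n - int m) / z n \<and>
             y (n + 1) = A + y (n - int m) / z n \<and>
             z (n + 1) = A + z (n - int m) / y n)"

end

theory Submission
  imports Defs
begin

text \<open>
  Call an index \<open>n\<close> large if \<open>n + q\<close> is even, with \<open>q = 0\<close> in (i) and \<open>q = 1\<close> in (ii).
  Terms above \<open>1/(1-A)\<close> at large indices and in \<open>(0,1)\<close> at the others reproduce themselves:
  since \<open>m + 1\<close> is even, \<open>t (n - m)\<close> and \<open>t (n + 1)\<close> have indices of the same kind and the divisor
  has the other kind, so \<open>t (n + 1) > A + t (n - m)\<close> at large indices, and
  \<open>t (n + 1) < A + (1 - A)\<close> at the others. The first inequality forces at least linear growth
  at large indices; the divisors then tend to infinity and the remaining terms to \<open>A\<close>.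
\<close>

definition alternating_at :: "real \<Rightarrow> int \<Rightarrow> (int \<Rightarrow> real) \<Rightarrow> int \<Rightarrow> bool" where
  "alternating_at A q t n \<longleftrightarrow>
     (if even (n + q) then t n > 1 / (1 - A) else 0 < t n \<and> t n < 1)"

text \<open>Treating one parity class as a filter lets divergence and convergence be proved directly
  in the index \<open>n\<close> of the recursion. The subsequences at \<open>2 * int n\<close> and
  \<open>2 * int n + 1\<close> are recovered at the end by composition, and \<open>q + 1\<close>
  always denotes the opposite class.\<close>

definition parity_at_top :: "int \<Rightarrow> int filter" where
  "parity_at_top q = inf at_top (principal {n. even (n + q)})"

lemma eventually_parity_at_top:
  "eventually P (parity_at_top q) \<longleftrightarrow> (\<exists>N. \<forall>n\<ge>N. even (n + q) \<longrightarrow> P n)"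
  by (auto simp: parity_at_top_def eventually_inf_principal eventually_at_top_linorder)

lemma filterlim_parity_at_top:
  assumes "even (r + q)"
  shows "filterlim (\<lambda>n. 2 * int n + r) (parity_at_top q) sequentially"
  unfolding filterlim_iff
proof (intro allI impI)
  fix P assume "eventually P (parity_at_top q)"
  then obtain N where N: "\<And>n. n \<ge> N \<Longrightarrow> even (n + q) \<Longrightarrow> P n"
    by (auto simp: eventually_parity_at_top)
  have "P (2 * int n + r)" if "n \<ge> nat (\<bar>N\<bar> + \<bar>r\<bar>)" for n
    using that assms by (intro N) (linarith, simp add: add.assoc)
  then show "\<forall>\<^sub>F n in sequentially. P (2 * int n + r)"
    by (auto simp: eventually_sequentially)
qed

text \<open>The recursion for \<open>t n\<close> divides by \<open>d (n - 1)\<close>, whose index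
  lies in the other class; this shift carries divergence of the divisors over to the class of
  \<open>n\<close>.\<close>

lemma filterlim_minus_one_parity_at_top:
  "filterlim (\<lambda>n. n - 1) (parity_at_top q) (parity_at_top (q + 1))"
  unfolding filterlim_iff
proof (intro allI impI)
  fix P assume "eventually P (parity_at_top q)"
  then obtain N where N: "\<And>n. n \<ge> N \<Longrightarrow> even (n + q) \<Longrightarrow> P n"
    by (auto simp: eventually_parity_at_top)
  have "\<forall>n\<ge>N + 1. even (n + (q + 1)) \<longrightarrow> P (n - 1)"
    using N by auto
  then show "\<forall>\<^sub>F n in parity_at_top (q + 1). P (n - 1)"
    unfolding eventually_parity_at_top by blast
qed

text \<open>The numerator sequence \<open>t\<close> and the divisor \<open>d\<close> are kept
  separate so that all three equations are covered: \<open>z\<close> divides for \<open>x\<close>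
  and \<open>y\<close>, while \<open>y\<close> divides for \<open>z\<close>.\<close>

lemma alternating_at_step:
  assumes A: "0 < A" "A < 1" and "odd m"
    and rec: "t (n + 1) = A + t (n - int m) / d n"
    and t: "alternating_at A q t (n - int m)" and d: "alternating_at A q d n"
  shows "alternating_at A q t (n + 1)"
proof (cases "even (n + q)")
  case True
  then have tb: "0 < t (n - int m)" "t (n - int m) < 1" and db: "d n > 1 / (1 - A)"
    using t d \<open>odd m\<close> by (auto simp: alternating_at_def)
  have "0 < 1 / (1 - A)" using A by simp
  with db have dpos: "0 < d n" by linarith
  \<comment> \<open>The threshold \<open>1 / (1 - A)\<close> is chosen for this: a numerator below 1
    then gives a quotient below \<open>1 - A\<close>, which leaves room for the summand
    \<open>A\<close>.\<close>
  have "1 < d n * (1 - A)" using db A by (simp add: field_simps)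
  then have "t (n - int m) / d n < 1 - A"
    using tb dpos by (simp add: field_simps)
  then show ?thesis
    using True tb dpos A by (simp add: alternating_at_def rec add_pos_pos)
next
  case False
  then have tb: "t (n - int m) > 1 / (1 - A)" and db: "0 < d n" "d n < 1"
    using t d \<open>odd m\<close> by (auto simp: alternating_at_def)
  have "0 < 1 / (1 - A)" using A by simp
  with tb have tpos: "0 < t (n - int m)" by linarith
  with db have "t (n - int m) < t (n - int m) / d n"
    by (simp add: field_simps)
  with tb A(1) have "1 / (1 - A) < t (n + 1)"
    unfolding rec by linarith
  then show ?thesis
    using False by (simp add: alternating_at_def)
qed

text \<open>Strong induction on the distance from \<open>- int m\<close> is used because a term
  depends on its predecessor and on the term \<open>m + 1\<close> places back; the
  \<open>m + 1\<close> initial values form the base.\<close>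

lemma positive_solution_alternating_at:
  assumes "0 < A" "A < 1" "odd m" and sol: "positive_solution A m x y z"
    and init: "\<And>n. - int m \<le> n \<Longrightarrow> n \<le> 0 \<Longrightarrow>
      alternating_at A q x n \<and> alternating_at A q y n \<and> alternating_at A q z n"
    and "- int m \<le> n"
  shows "alternating_at A q x n \<and> alternating_at A q y n \<and> alternating_at A q z n"
  using \<open>- int m \<le> n\<close>
proof (induction "nat (n + int m)" arbitrary: n rule: less_induct)
  case less
  show ?case
  proof (cases "n \<le> 0")
    case True
    with less.prems init show ?thesis by blast
  next
    case False
    define k where "k = n - 1"
    have n: "n = k + 1" and k: "0 \<le> k" using False by (auto simp: k_def)
    have old: "alternating_at A q x (k - int m)" "alternating_at A q y (k - int m)"
        "alternating_at A q z (k - int m)"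
      using less.hyps[of "k - int m"] k by (auto simp: n)
    have divisor: "alternating_at A q y k" "alternating_at A q z k"
      using less.hyps[of k] k by (auto simp: n)
    show ?thesis
      using sol k old divisor assms(1-3)
      unfolding n positive_solution_def by (blast intro: alternating_at_step)
  qed
qed

text \<open>At large indices the divisor lies in (0,1), so every jump of \<open>m + 1\<close>
  indices stays in the class and gains at least \<open>A\<close>.\<close>

lemma alternating_filterlim_at_top:
  assumes A: "0 < A" "A < 1" and "odd m"
    and rec: "\<And>n. 0 \<le> n \<Longrightarrow> t (n + 1) = A + t (n - int m) / d n"
    and t: "\<And>n. - int m \<le> n \<Longrightarrow> alternating_at A q t n"
    and d: "\<And>n. - int m \<le> n \<Longrightarrow> alternating_at A q d n"
  shows "filterlim t at_top (parity_at_top q)"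
proof -
  have pos: "0 < t n" if "- int m \<le> n" "even (n + q)" for n
  proof -
    have "0 < 1 / (1 - A)" using A by simp
    with t[OF that(1)] that(2) show ?thesis
      unfolding alternating_at_def by (simp del: zero_less_divide_1_iff)
  qed
  \<comment> \<open>For \<open>j = 0\<close> the threshold is the first index
    \<open>- int m\<close>, where positivity suffices. Raising \<open>j\<close> by one moves it by
    \<open>m + 1\<close>, exactly the reach of the recursion.\<close>
  have growth: "real j * A \<le> t n"
    if "int j * (int m + 1) - int m \<le> n" "even (n + q)" for n j
    using that
  proof (induction j arbitrary: n)
    case 0
    then show ?case using pos[of n] by simp
  next
    case (Suc j)
    define k where "k = n - 1"
    have n: "n = k + 1" by (simp add: k_def)
    have j0: "0 \<le> int j * (int m + 1)" by simp
    have le: "int j * (int m + 1) - int m \<le> k - int m"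
      using Suc.prems(1) by (simp add: n algebra_simps)
    then have k: "0 \<le> k" using j0 by linarith
    have old_even: "even (k - int m + q)" using Suc.prems(2) \<open>odd m\<close> by (simp add: n)
    have IH: "real j * A \<le> t (k - int m)" using Suc.IH[OF le old_even] .
    have tpos: "0 < t (k - int m)" using pos old_even k by simp
    have "0 < d k" "d k < 1"
      using d[of k] k Suc.prems(2) by (auto simp: alternating_at_def n)
    then have "t (k - int m) \<le> t (k - int m) / d k"
      using tpos by (simp add: field_simps)
    with IH rec[OF k] show ?case by (simp add: n algebra_simps)
  qed
  show ?thesis
    unfolding filterlim_at_top
  proof
    fix C
    obtain j where "C < real j * A" using reals_Archimedean3[OF A(1)] by blast
    then have "\<forall>n\<ge>int j * (int m + 1) - int m. even (n + q) \<longrightarrow> C \<le> t n"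
      using growth by fastforce
    then show "\<forall>\<^sub>F n in parity_at_top q. C \<le> t n"
      unfolding eventually_parity_at_top by blast
  qed
qed

text \<open>At small indices \<open>t n - A\<close> is a quotient with numerator in (0,1), hence at
  most the reciprocal of a divisor that tends to infinity.\<close>

lemma alternating_tendsto:
  assumes "odd m"
    and rec: "\<And>n. 0 \<le> n \<Longrightarrow> t (n + 1) = A + t (n - int m) / d n"
    and t: "\<And>n. - int m \<le> n \<Longrightarrow> alternating_at A q t n"
    and d: "filterlim d at_top (parity_at_top q)"
  shows "(t \<longlongrightarrow> A) (parity_at_top (q + 1))"
proof -
  have shifted: "filterlim (\<lambda>n. d (n - 1)) at_top (parity_at_top (q + 1))"
    using filterlim_compose[OF d filterlim_minus_one_parity_at_top] .
  have null: "((\<lambda>n. inverse (d (n - 1))) \<longlongrightarrow> 0) (parity_at_top (q + 1))"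
    by (rule filterlim_compose[OF tendsto_inverse_0_at_top[OF filterlim_ident] shifted])
  have bound: "\<forall>\<^sub>F n in parity_at_top (q + 1). norm (t n - A) \<le> norm (inverse (d (n - 1))) * 1"
  proof -
    \<comment> \<open>From \<open>n \<ge> 1\<close> on, the recursion applies at
      \<open>n - 1\<close> and the numerator index is at least \<open>- int m\<close>; the parity
      makes that numerator a small term.\<close>
    have large: "\<forall>\<^sub>F n in parity_at_top (q + 1). n \<ge> 1 \<and> even (n + (q + 1))"
      unfolding eventually_parity_at_top by blast
    \<comment> \<open>Divergence alone supplies the positive sign of the divisor needed in the norm
      estimate.\<close>
    have "\<forall>\<^sub>F n in parity_at_top (q + 1). 1 \<le> d (n - 1)"
      using shifted by (simp add: filterlim_at_top)
    then show ?thesis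
      using large
    proof eventually_elim
      case (elim n)
      have "0 < t (n - 1 - int m)" "t (n - 1 - int m) < 1"
        using t[of "n - 1 - int m"] elim \<open>odd m\<close> by (auto simp: alternating_at_def)
      moreover have "t n - A = t (n - 1 - int m) / d (n - 1)"
        using rec[of "n - 1"] elim by simp
      ultimately show ?case
        using elim by (simp add: divide_right_mono inverse_eq_divide)
    qed
  qed
  have "((\<lambda>n. t n - A) \<longlongrightarrow> 0) (parity_at_top (q + 1))"
    by (rule tendsto_0_le[OF null bound])
  then show ?thesis by (simp add: LIM_zero_iff)
qed

text \<open>Divergence comes first, from the alternation alone. The limits \<open>A\<close> then
  follow from the divergence of the respective divisor: \<open>z\<close> for \<open>x\<close> and
  \<open>y\<close>, and \<open>y\<close> for \<open>z\<close>.\<close>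

lemma positive_solution_limits:
  assumes A: "0 < A" "A < 1" and "odd m" and sol: "positive_solution A m x y z"
    and init: "\<And>n. - int m \<le> n \<Longrightarrow> n \<le> 0 \<Longrightarrow>
      alternating_at A q x n \<and> alternating_at A q y n \<and> alternating_at A q z n"
  shows "filterlim x at_top (parity_at_top q)" "filterlim y at_top (parity_at_top q)"
    "filterlim z at_top (parity_at_top q)"
    "(x \<longlongrightarrow> A) (parity_at_top (q + 1))" "(y \<longlongrightarrow> A) (parity_at_top (q + 1))"
    "(z \<longlongrightarrow> A) (parity_at_top (q + 1))"
proof -
  have alt: "alternating_at A q x n" "alternating_at A q y n" "alternating_at A q z n"
    if "- int m \<le> n" for n
    using positive_solution_alternating_at[OF A \<open>odd m\<close> sol init that] by auto
  have rec: "x (n + 1) = A + x (n - int m) / z n" "y (n + 1) = A + y (n - int m) / z n"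
    "z (n + 1) = A + z (n - int m) / y n" if "0 \<le> n" for n
    using sol that by (auto simp: positive_solution_def)
  note top = alternating_filterlim_at_top[OF A \<open>odd m\<close>]
  show "filterlim x at_top (parity_at_top q)" by (rule top[OF rec(1) alt(1) alt(3)])
  show y: "filterlim y at_top (parity_at_top q)" by (rule top[OF rec(2) alt(2) alt(3)])
  show z: "filterlim z at_top (parity_at_top q)" by (rule top[OF rec(3) alt(3) alt(2)])
  note lim = alternating_tendsto[OF \<open>odd m\<close>]
  show "(x \<longlongrightarrow> A) (parity_at_top (q + 1))" by (rule lim[OF rec(1) alt(1) z])
  show "(y \<longlongrightarrow> A) (parity_at_top (q + 1))" by (rule lim[OF rec(2) alt(2) z])
  show "(z \<longlongrightarrow> A) (parity_at_top (q + 1))" by (rule lim[OF rec(3) alt(3) y])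
qed

theorem theorem3p2:
  fixes A :: real and m :: nat and x y z :: "int \<Rightarrow> real"
  assumes "m > 0" and "0 < A" and "A < 1"
    and "positive_solution A m x y z"
  shows
    "(odd m \<and>
      (\<forall>k\<in>{(1 - int m) div 2..0}.
         0 < x (2 * k - 1) \<and> x (2 * k - 1) < 1 \<and>
         0 < y (2 * k - 1) \<and> y (2 * k - 1) < 1 \<and>
         0 < z (2 * k - 1) \<and> z (2 * k - 1) < 1 \<and>
         x (2 * k) > 1 / (1 - A) \<and> y (2 * k) > 1 / (1 - A) \<and> z (2 * k) > 1 / (1 - A))
      \<longrightarrow>
      filterlim (\<lambda>n. x (2 * int n)) at_top sequentially \<and>
      filterlim (\<lambda>n. y (2 * int n)) at_top sequentially \<and>
      filterlim (\<lambda>n. z (2 * int n)) at_top sequentially \<and>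
      (\<lambda>n. x (2 * int n + 1)) \<longlonglongrightarrow> A \<and>
      (\<lambda>n. y (2 * int n + 1)) \<longlonglongrightarrow> A \<and>
      (\<lambda>n. z (2 * int n + 1)) \<longlonglongrightarrow> A)
     \<and>
     (odd m \<and>
      (\<forall>k\<in>{(1 - int m) div 2..0}.
         0 < x (2 * k) \<and> x (2 * k) < 1 \<and>
         0 < y (2 * k) \<and> y (2 * k) < 1 \<and>
         0 < z (2 * k) \<and> z (2 * k) < 1 \<and>
         x (2 * k - 1) > 1 / (1 - A) \<and> y (2 * k - 1) > 1 / (1 - A) \<and>
         z (2 * k - 1) > 1 / (1 - A))
      \<longrightarrow>
      (\<lambda>n. x (2 * int n)) \<longlonglongrightarrow> A \<and>
      (\<lambda>n. y (2 * int n)) \<longlonglongrightarrow> A \<and>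
      (\<lambda>n. z (2 * int n)) \<longlonglongrightarrow> A \<and>
      filterlim (\<lambda>n. x (2 * int n + 1)) at_top sequentially \<and>
      filterlim (\<lambda>n. y (2 * int n + 1)) at_top sequentially \<and>
      filterlim (\<lambda>n. z (2 * int n + 1)) at_top sequentially)"
proof (intro conjI[of "_ \<longrightarrow> _" "_ \<longrightarrow> _"] impI, goal_cases)
  case 1
  then have "odd m" and I: "\<forall>k\<in>{(1 - int m) div 2..0}.
         0 < x (2 * k - 1) \<and> x (2 * k - 1) < 1 \<and>
         0 < y (2 * k - 1) \<and> y (2 * k - 1) < 1 \<and>
         0 < z (2 * k - 1) \<and> z (2 * k - 1) < 1 \<and>
         x (2 * k) > 1 / (1 - A) \<and> y (2 * k) > 1 / (1 - A) \<and> z (2 * k) > 1 / (1 - A)"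
    by blast+
  \<comment> \<open>Since \<open>m\<close> is odd, the pairs \<open>2 * k - 1\<close>,
    \<open>2 * k\<close> exhaust the indices from \<open>- int m\<close> to 0: the lowest pair is
    \<open>- int m\<close>, \<open>1 - int m\<close>, and the division by 2 is exact.\<close>
  have init: "alternating_at A 0 x n \<and> alternating_at A 0 y n \<and> alternating_at A 0 z n"
    if n: "- int m \<le> n" "n \<le> 0" for n
  proof (cases "even n")
    case True
    then obtain k where k: "n = 2 * k" by blast
    have "k \<in> {(1 - int m) div 2..0}" using n \<open>odd m\<close> k by (auto elim!: oddE)
    with I k show ?thesis by (simp add: alternating_at_def)
  next
    case False
    then have "even (n + 1)" by simp
    then obtain k where "n + 1 = 2 * k" by blast
    then have k: "n = 2 * k - 1" by simp
    have "k \<in> {(1 - int m) div 2..0}" using n \<open>odd m\<close> k by (auto elim!: oddE)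
    with I k show ?thesis by (simp add: alternating_at_def)
  qed
  note limits = positive_solution_limits[OF assms(2,3) \<open>odd m\<close> assms(4) init]
  have even_indices: "filterlim (\<lambda>n. 2 * int n) (parity_at_top 0) sequentially"
    using filterlim_parity_at_top[of 0 0] by simp
  have odd_indices: "filterlim (\<lambda>n. 2 * int n + 1) (parity_at_top (0 + 1)) sequentially"
    by (rule filterlim_parity_at_top) simp
  show ?case
    by (intro conjI; rule filterlim_compose[OF _ even_indices] filterlim_compose[OF _ odd_indices];
      rule limits; assumption)
next
  case 2
  then have "odd m" and I: "\<forall>k\<in>{(1 - int m) div 2..0}.
         0 < x (2 * k) \<and> x (2 * k) < 1 \<and>
         0 < y (2 * k) \<and> y (2 * k) < 1 \<and>
         0 < z (2 * k) \<and> z (2 * k) < 1 \<and>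
         x (2 * k - 1) > 1 / (1 - A) \<and> y (2 * k - 1) > 1 / (1 - A) \<and>
         z (2 * k - 1) > 1 / (1 - A)"
    by blast+
  have init: "alternating_at A 1 x n \<and> alternating_at A 1 y n \<and> alternating_at A 1 z n"
    if n: "- int m \<le> n" "n \<le> 0" for n
  proof (cases "even n")
    case True
    then obtain k where k: "n = 2 * k" by blast
    have "k \<in> {(1 - int m) div 2..0}" using n \<open>odd m\<close> k by (auto elim!: oddE)
    with I k show ?thesis by (simp add: alternating_at_def)
  next
    case False
    then have "even (n + 1)" by simp
    then obtain k where "n + 1 = 2 * k" by blast
    then have k: "n = 2 * k - 1" by simp
    have "k \<in> {(1 - int m) div 2..0}" using n \<open>odd m\<close> k by (auto elim!: oddE)
    with I k show ?thesis by (simp add: alternating_at_def)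
  qed
  note limits = positive_solution_limits[OF assms(2,3) \<open>odd m\<close> assms(4) init]
  \<comment> \<open>With \<open>q = 1\<close> the small class is \<open>q + 1 = 1 + 1\<close>, again
    the even indices; the sum is left unevaluated to match \<open>limits\<close>.\<close>
  have even_indices: "filterlim (\<lambda>n. 2 * int n) (parity_at_top (1 + 1)) sequentially"
    using filterlim_parity_at_top[of 0 "1 + 1"] by simp
  have odd_indices: "filterlim (\<lambda>n. 2 * int n + 1) (parity_at_top 1) sequentially"
    by (rule filterlim_parity_at_top) simp
  show ?case
    by (intro conjI; rule filterlim_compose[OF _ even_indices] filterlim_compose[OF _ odd_indices];
      rule limits; assumption)
qed

end
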